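(* Consider the eigenvalue problem $$\Delta_h(r_k\Delta_h x_k) + (\lambda w_k - q_k)x_{k+1} = 0, \quad k = 0,\ldots,n-1, \qquad x_0 = x_{n+1} = 0.$$ If $\lambda \in \mathbb{C}$ is an eigenvalue of this problem, then $\lambda$ is real. Moreover, the problem has exactly $n$ eigenvalues, counted with multiplicity.
   Context: Let $n \ge 1$ be an integer and let $t_0 < t_1 < \cdots < t_{n+1}$ be real grid points with step sizes $h_k = t_{k+1}-t_k > 0$, which may vary with $k$. For a sequence $f$, $\Delta_h f_k = \dfrac{f_{k+1}-f_k}{h_k}$, so $\Delta_h(r_k\Delta_h x_k) = \dfrac{1}{h_k}\left(r_{k+1}\dfrac{x_{k+2}-x_{k+1}}{h_{k+1}} - r_k\dfrac{x_{k+1}-x_k}{h_k}\right)$. The coefficients $r_k, w_k, q_k$ are real sequences with $r_k \neq 0$ and $w_k > 0$ for all $k$. A number $\lambda\in\mathbb{C}$ is an eigenvalue if the problem has a nontrivial (not identically zero, possibly complex-valued) solution $(x_k)_{k=0}^{n+1}$. Multiplicity: in terms of the interior unknowns $(x_1,\ldots,x_n)$, the problem is the linear system $(B-\lambda D)(x_1,\dots,x_n)^{T}=0$, where $D$ is the $n\times n$ diagonal matrix with $D_{j,j}=h_{j-1}w_{j-1}$ and $B$ is the $n\times n$ symmetric tridiagonal matrix with $B_{j,j} = \frac{r_j}{h_j}+\frac{r_{j-1}}{h_{j-1}}+h_{j-1}q_{j-1}$ for $1\le j\le n$ and $B_{j,j+1}=B_{j+1,j}=-\frac{r_j}{h_j}$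 for $1\le j\le n-1$. The multiplicity of an eigenvalue is its multiplicity as a root of the polynomial $\det(B-\lambda D)$ in $\lambda$. *)

theory Defs
  imports Complex_Main "HOL-Computational_Algebra.Polynomial" "Jordan_Normal_Form.Determinant"
begin

definition step :: "(nat \<Rightarrow> real) \<Rightarrow> nat \<Rightarrow> real" where
  "step t k = t (Suc k) - t k"

definition hdiff :: "(nat \<Rightarrow> real) \<Rightarrow> (nat \<Rightarrow> complex) \<Rightarrow> nat \<Rightarrow> complex" where
  "hdiff t f k = (f (Suc k) - f k) / of_real (step t k)"

text \<open>Sequences are total functions on the naturals, but only the values
  \<open>x 0, \<dots>, x (n + 1)\<close> of a solution matter; in particular nontriviality is
  required on these indices.\<close>

definition is_solution ::
  "nat \<Rightarrow> (nat \<Rightarrow> real) \<Rightarrow> (nat \<Rightarrow> real) \<Rightarrow> (nat \<Rightarrow> real) \<Rightarrow> (nat \<Rightarrow> real) \<Rightarrow>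
    complex \<Rightarrow> (nat \<Rightarrow> complex) \<Rightarrow> bool" where
  "is_solution n t r w q lam x \<longleftrightarrow>
     (\<forall>k<n. hdiff t (\<lambda>j. of_real (r j) * hdiff t x j) k
              + (lam * of_real (w k) - of_real (q k)) * x (Suc k) = 0) \<and>
     x 0 = 0 \<and> x (Suc n) = 0"

definition is_eigenvalue ::
  "nat \<Rightarrow> (nat \<Rightarrow> real) \<Rightarrow> (nat \<Rightarrow> real) \<Rightarrow> (nat \<Rightarrow> real) \<Rightarrow> (nat \<Rightarrow> real) \<Rightarrow>
    complex \<Rightarrow> bool" where
  "is_eigenvalue n t r w q lam \<longleftrightarrow>
     (\<exists>x. is_solution n t r w q lam x \<and> (\<exists>k\<le>Suc n. x k \<noteq> 0))"

text \<open>Matrix indices start at 0: row \<open>i\<close> belongs to the unknown \<open>x (i + 1)\<close>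
  and to the difference equation with \<open>k = i\<close> (multiplied by \<open>- step t i\<close>).\<close>

definition B_mat ::
  "nat \<Rightarrow> (nat \<Rightarrow> real) \<Rightarrow> (nat \<Rightarrow> real) \<Rightarrow> (nat \<Rightarrow> real) \<Rightarrow> real mat" where
  "B_mat n t r q = mat n n (\<lambda>(i, j).
     if i = j then r (Suc i) / step t (Suc i) + r i / step t i + step t i * q i
     else if j = Suc i then - (r j / step t j)
     else if i = Suc j then - (r i / step t i)
     else 0)"

definition D_mat :: "nat \<Rightarrow> (nat \<Rightarrow> real) \<Rightarrow> (nat \<Rightarrow> real) \<Rightarrow> real mat" where
  "D_mat n t w = mat n n (\<lambda>(i, j). if i = j then step t i * w i else 0)"

text \<open>\<open>det (B - lam D)\<close> as a complex polynomial in \<open>lam\<close>; the indeterminate is \<open>[:0, 1:]\<close>.\<close>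

definition pencil_poly ::
  "nat \<Rightarrow> (nat \<Rightarrow> real) \<Rightarrow> (nat \<Rightarrow> real) \<Rightarrow> (nat \<Rightarrow> real) \<Rightarrow> (nat \<Rightarrow> real) \<Rightarrow>
    complex poly" where
  "pencil_poly n t r w q =
     det (map_mat (\<lambda>b. [:of_real b:]) (B_mat n t r q)
          - [:0, 1:] \<cdot>\<^sub>m map_mat (\<lambda>d. [:of_real d:]) (D_mat n t w))"

definition eig_multiplicity ::
  "nat \<Rightarrow> (nat \<Rightarrow> real) \<Rightarrow> (nat \<Rightarrow> real) \<Rightarrow> (nat \<Rightarrow> real) \<Rightarrow> (nat \<Rightarrow> real) \<Rightarrow>
    complex \<Rightarrow> nat" where
  "eig_multiplicity n t r w q lam = Polynomial.order lam (pencil_poly n t r w q)"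

end

theory Submission
  imports Defs "Jordan_Normal_Form.Char_Poly"
    "HOL-Computational_Algebra.Fundamental_Theorem_Algebra"
begin

text \<open>Two independent ideas prove the theorem.

  Reality is self-adjointness, read off from the difference equation itself. Multiply equation
  \<open>k\<close> by \<open>step t k\<close> times the conjugate of \<open>x (k + 1)\<close>, sum over \<open>k\<close>, and sum by parts. The
  Dirichlet conditions remove the boundary terms and leave
  \<open>(\<Sum>k<n. h k * (lam * w k - q k) * (cmod (x (k + 1)))\<^sup>2) = (\<Sum>k\<le>n. r k * h k * (cmod (hdiff t x k))\<^sup>2)\<close>
  with \<open>h = step t\<close> (lemma \<open>energy_identity\<close>). Everything except \<open>lam\<close> is real, and \<open>lam\<close> is
  multiplied by a positive number because \<open>w\<close> and \<open>h\<close> are positive and \<open>x\<close> is nontrivial.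

  The count is the fundamental theorem of algebra. As \<open>D\<close> is an invertible diagonal matrix,
  \<open>det (B - lam D)\<close> is, up to a nonzero constant, the characteristic polynomial of \<open>D\<inverse> B\<close>
  (lemma \<open>pencil_poly_eq_char_poly\<close>): it has degree \<open>n\<close>, and its roots are the eigenvalues of
  \<open>D\<inverse> B\<close>. These are exactly the eigenvalues of the boundary value problem, because
  \<open>D\<inverse> B v = lam v\<close> is the system of difference equations for the sequence obtained from \<open>v\<close> by
  appending a zero at both ends (lemma \<open>is_eigenvalue_iff_eigenvalue\<close>).\<close>

section \<open>Eigenvalues are real\<close>

lemma summation_by_parts:
  fixes f g :: "nat \<Rightarrow> 'a :: comm_ring_1"
  shows "(\<Sum>k<n. f (Suc k) * (g (Suc k) - g k)) = f n * g n - f 0 * g 0 - (\<Sum>k<n. (f (Suc k) - f k) * g k)"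
  by (induction n) (simp_all add: algebra_simps)

lemma energy_identity:
  assumes sol: "is_solution n t r w q lam x" and step: "\<And>k. k \<le> n \<Longrightarrow> step t k \<noteq> 0"
  shows "(\<Sum>k<n. (lam * of_real (w k) - of_real (q k)) * of_real (step t k * (cmod (x (Suc k)))\<^sup>2))
       = of_real (\<Sum>k\<le>n. r k * step t k * (cmod (hdiff t x k))\<^sup>2)"
proof -
  define F where "F k = of_real (r k) * hdiff t x k" for k
  have x0: "x 0 = 0" and xn: "x (Suc n) = 0"
    and eq: "\<And>k. k < n \<Longrightarrow> hdiff t F k + (lam * of_real (w k) - of_real (q k)) * x (Suc k) = 0"
    using sol by (auto simp: is_solution_def F_def[abs_def])
  have cnj_diff: "(cnj (x (Suc k)) - cnj (x k)) * F k = of_real (r k * step t k * (cmod (hdiff t x k))\<^sup>2)"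
    if "k \<le> n" for k
  proof -
    have "x (Suc k) - x k = of_real (step t k) * hdiff t x k"
      using step[OF that] by (simp add: hdiff_def)
    then have "cnj (x (Suc k)) - cnj (x k) = of_real (step t k) * cnj (hdiff t x k)"
      by (metis complex_cnj_diff complex_cnj_mult complex_cnj_complex_of_real)
    then show ?thesis
      by (simp add: F_def complex_norm_square mult_ac del: of_real_power)
  qed
  have "(\<Sum>k<n. (lam * of_real (w k) - of_real (q k)) * of_real (step t k * (cmod (x (Suc k)))\<^sup>2))
      = - (\<Sum>k<n. cnj (x (Suc k)) * (F (Suc k) - F k))"
    unfolding sum_negf[symmetric]
  proof (rule sum.cong)
    fix k assume "k \<in> {..<n}"
    then have k: "k < n" by simp
    have "F (Suc k) - F k = of_real (step t k) * hdiff t F k"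
      using step[of k] k by (simp add: hdiff_def)
    moreover have "hdiff t F k = - ((lam * of_real (w k) - of_real (q k)) * x (Suc k))"
      using eq[OF k] by (simp add: eq_neg_iff_add_eq_0)
    ultimately show "(lam * of_real (w k) - of_real (q k)) * of_real (step t k * (cmod (x (Suc k)))\<^sup>2)
        = - (cnj (x (Suc k)) * (F (Suc k) - F k))"
      by (simp add: complex_norm_square mult_ac del: of_real_power)
  qed simp
  also have "\<dots> = (\<Sum>k<n. (cnj (x (Suc k)) - cnj (x k)) * F k) - cnj (x n) * F n"
    unfolding summation_by_parts[of "\<lambda>k. cnj (x k)"] using x0 by simp
  \<comment> \<open>The boundary term is the summand \<open>k = n\<close>, since \<open>x (n + 1) = 0\<close>.\<close>
  also have "\<dots> = (\<Sum>k\<le>n. (cnj (x (Suc k)) - cnj (x k)) * F k)"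
    using xn by (simp add: lessThan_Suc_atMost[symmetric])
  also have "\<dots> = (\<Sum>k\<le>n. of_real (r k * step t k * (cmod (hdiff t x k))\<^sup>2))"
    by (rule sum.cong) (use cnj_diff in auto)
  finally show ?thesis by simp
qed

lemma eigenvalue_real:
  assumes step: "\<And>k. k \<le> n \<Longrightarrow> step t k > 0" and w: "\<And>k. k < n \<Longrightarrow> w k > 0"
    and ev: "is_eigenvalue n t r w q lam"
  shows "lam \<in> \<real>"
proof -
  from ev obtain x k where sol: "is_solution n t r w q lam x" and k: "k \<le> Suc n" "x k \<noteq> 0"
    by (auto simp: is_eigenvalue_def)
  have "x 0 = 0" "x (Suc n) = 0"
    using sol by (auto simp: is_solution_def)
  with k obtain j where j: "j < n" "x (Suc j) \<noteq> 0"
    by (metis Suc_le_lessD le_SucE not0_implies_Suc)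
  let ?c = "\<lambda>k. step t k * (cmod (x (Suc k)))\<^sup>2"
  have nonneg: "w k * ?c k \<ge> 0" if "k < n" for k
    using step[of k] w[OF that] that by simp
  have "w j * ?c j > 0"
    using step[of j] w[of j] j by simp
  then have pos: "(\<Sum>k<n. w k * ?c k) > 0"
    using nonneg j(1) by (intro sum_pos2[of _ j]) auto
  have "(\<Sum>k<n. (lam * of_real (w k) - of_real (q k)) * of_real (?c k))
      = of_real (\<Sum>k\<le>n. r k * step t k * (cmod (hdiff t x k))\<^sup>2)"
    using step by (intro energy_identity[OF sol]) force
  then have "0 = Im (\<Sum>k<n. (lam * of_real (w k) - of_real (q k)) * of_real (?c k))"
    by (simp only: Im_complex_of_real)
  also have "\<dots> = (\<Sum>k<n. Im lam * (w k * ?c k))"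
    by (simp del: of_real_mult of_real_power add: mult_ac)
  also have "\<dots> = Im lam * (\<Sum>k<n. w k * ?c k)"
    by (rule sum_distrib_left[symmetric])
  finally show ?thesis
    using pos by (simp add: complex_is_Real_iff)
qed

section \<open>The boundary value problem as a matrix eigenvalue problem\<close>

text \<open>The matrix \<open>D\<inverse> B\<close>; its complex eigenvalues are those of the pencil \<open>B - lam D\<close>.\<close>

definition DB_mat ::
  "nat \<Rightarrow> (nat \<Rightarrow> real) \<Rightarrow> (nat \<Rightarrow> real) \<Rightarrow> (nat \<Rightarrow> real) \<Rightarrow> (nat \<Rightarrow> real) \<Rightarrow> complex mat" where
  "DB_mat n t r w q = mat n n (\<lambda>(i, j). of_real (B_mat n t r q $$ (i, j) / (step t i * w i)))"

lemma DB_mat_carrier: "DB_mat n t r w q \<in> carrier_mat n n"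
  by (simp add: DB_mat_def)

text \<open>The first and last row of \<open>B\<close> lack one off-diagonal entry. The term that it would
  contribute contains \<open>x 0\<close> or \<open>x (n + 1)\<close> and vanishes, so that all rows have the same form.\<close>

lemma B_mat_row_sum:
  fixes x :: "nat \<Rightarrow> complex"
  assumes i: "i < n" and x0: "x 0 = 0" and xn: "x (Suc n) = 0"
  shows "(\<Sum>j<n. of_real (B_mat n t r q $$ (i, j)) * x (Suc j))
       = of_real (r (Suc i) / step t (Suc i) + r i / step t i + step t i * q i) * x (Suc i)
         - of_real (r (Suc i) / step t (Suc i)) * x (Suc (Suc i)) - of_real (r i / step t i) * x i"
proof -
  let ?d = "of_real (r (Suc i) / step t (Suc i) + r i / step t i + step t i * q i) * x (Suc i)"
  let ?u = "- of_real (r (Suc i) / step t (Suc i)) * x (Suc (Suc i))"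
  let ?l = "- of_real (r i / step t i) * x i"
  have "(\<Sum>j<n. of_real (B_mat n t r q $$ (i, j)) * x (Suc j))
      = (\<Sum>j<n. (if j = i then ?d else 0) + (if j = Suc i then ?u else 0) + (if Suc j = i then ?l else 0))"
    by (rule sum.cong) (use i in \<open>auto simp: B_mat_def\<close>)
  also have "\<dots> = (\<Sum>j<n. if j = i then ?d else 0) + (\<Sum>j<n. if j = Suc i then ?u else 0)
      + (\<Sum>j<n. if Suc j = i then ?l else 0)"
    by (simp add: sum.distrib)
  also have "(\<Sum>j<n. if j = i then ?d else 0) = ?d"
    using i by simp
  also have "(\<Sum>j<n. if j = Suc i then ?u else 0) = ?u"
  proof (cases "Suc i < n")
    case False
    with i have "Suc i = n" by simp
    with xn have "x (Suc (Suc i)) = 0" by simp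
    then show ?thesis by simp
  qed simp
  also have "(\<Sum>j<n. if Suc j = i then ?l else 0) = ?l"
    by (cases i) (use i x0 in auto)
  finally show ?thesis by simp
qed

lemma difference_equation_iff:
  fixes x :: "nat \<Rightarrow> complex"
  assumes h: "step t i \<noteq> 0" "step t (Suc i) \<noteq> 0"
  shows "hdiff t (\<lambda>j. of_real (r j) * hdiff t x j) i + (lam * of_real (w i) - of_real (q i)) * x (Suc i) = 0
    \<longleftrightarrow> of_real (r (Suc i) / step t (Suc i) + r i / step t i + step t i * q i) * x (Suc i)
        - of_real (r (Suc i) / step t (Suc i)) * x (Suc (Suc i)) - of_real (r i / step t i) * x i
        = lam * of_real (step t i * w i) * x (Suc i)" (is "?E = 0 \<longleftrightarrow> ?L = ?R")
proof -
  have "?L - ?R = - of_real (step t i) * ?E"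
    using h by (simp add: hdiff_def field_simps)
  moreover have "?E = 0 \<longleftrightarrow> - of_real (step t i) * ?E = 0"
    using h(1) by (simp only: mult_eq_0_iff neg_equal_0_iff_equal of_real_eq_0_iff simp_thms)
  ultimately have "?E = 0 \<longleftrightarrow> ?L - ?R = 0"
    by (simp only:)
  then show ?thesis
    by (simp only: right_minus_eq)
qed

lemma is_solution_iff_eigen_equation:
  assumes step: "\<And>k. k \<le> n \<Longrightarrow> step t k \<noteq> 0" and w: "\<And>k. k < n \<Longrightarrow> w k \<noteq> 0"
    and x0: "x 0 = 0" and xn: "x (Suc n) = 0"
  shows "is_solution n t r w q lam x
    \<longleftrightarrow> DB_mat n t r w q *\<^sub>v vec n (\<lambda>i. x (Suc i)) = lam \<cdot>\<^sub>v vec n (\<lambda>i. x (Suc i))"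
proof -
  let ?S = "\<lambda>i. \<Sum>j<n. of_real (B_mat n t r q $$ (i, j)) * x (Suc j)"
  have row: "(DB_mat n t r w q *\<^sub>v vec n (\<lambda>i. x (Suc i))) $ i = ?S i / of_real (step t i * w i)"
    if "i < n" for i
    using that by (simp add: DB_mat_def scalar_prod_def sum_divide_distrib lessThan_atLeast0)
  have "hdiff t (\<lambda>j. of_real (r j) * hdiff t x j) i + (lam * of_real (w i) - of_real (q i)) * x (Suc i) = 0
      \<longleftrightarrow> ?S i / of_real (step t i * w i) = lam * x (Suc i)" if i: "i < n" for i
  proof -
    have nz: "of_real (step t i * w i) \<noteq> (0 :: complex)"
      using step[of i] w[of i] i by simp
    have "hdiff t (\<lambda>j. of_real (r j) * hdiff t x j) i + (lam * of_real (w i) - of_real (q i)) * x (Suc i) = 0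
        \<longleftrightarrow> ?S i = lam * of_real (step t i * w i) * x (Suc i)"
      unfolding B_mat_row_sum[OF i x0 xn]
      by (rule difference_equation_iff) (use step i in auto)
    also have "\<dots> \<longleftrightarrow> ?S i / of_real (step t i * w i) = lam * x (Suc i)"
      unfolding nonzero_divide_eq_eq[OF nz] by (simp only: mult_ac)
    finally show ?thesis .
  qed
  moreover have "DB_mat n t r w q *\<^sub>v vec n (\<lambda>i. x (Suc i)) = lam \<cdot>\<^sub>v vec n (\<lambda>i. x (Suc i))
      \<longleftrightarrow> (\<forall>i<n. ?S i / of_real (step t i * w i) = lam * x (Suc i))"
    using DB_mat_carrier[of n t r w q] by (simp add: vec_eq_iff row del: index_mult_mat_vec)
  ultimately show ?thesis
    using x0 xn unfolding is_solution_def by blast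
qed

lemma is_eigenvalue_iff_eigenvalue:
  assumes step: "\<And>k. k \<le> n \<Longrightarrow> step t k \<noteq> 0" and w: "\<And>k. k < n \<Longrightarrow> w k \<noteq> 0"
  shows "is_eigenvalue n t r w q lam \<longleftrightarrow> eigenvalue (DB_mat n t r w q) lam"
proof
  assume "is_eigenvalue n t r w q lam"
  then obtain x k where sol: "is_solution n t r w q lam x" and k: "k \<le> Suc n" "x k \<noteq> 0"
    by (auto simp: is_eigenvalue_def)
  have x: "x 0 = 0" "x (Suc n) = 0"
    using sol by (auto simp: is_solution_def)
  with k obtain j where j: "j < n" "x (Suc j) \<noteq> 0"
    by (metis Suc_le_lessD le_SucE not0_implies_Suc)
  let ?v = "vec n (\<lambda>i. x (Suc i))"
  have "?v $ j \<noteq> 0\<^sub>v n $ j"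
    using j by simp
  then have "?v \<noteq> 0\<^sub>v n" by metis
  moreover have "DB_mat n t r w q *\<^sub>v ?v = lam \<cdot>\<^sub>v ?v"
    using is_solution_iff_eigen_equation[where n = n and w = w, OF step w x] sol by blast
  ultimately show "eigenvalue (DB_mat n t r w q) lam"
    unfolding eigenvalue_def eigenvector_def carrier_matD(1)[OF DB_mat_carrier]
    by (intro exI[of _ ?v]) simp
next
  assume "eigenvalue (DB_mat n t r w q) lam"
  then obtain v where v: "v \<in> carrier_vec n" "v \<noteq> 0\<^sub>v n" "DB_mat n t r w q *\<^sub>v v = lam \<cdot>\<^sub>v v"
    by (auto simp: eigenvalue_def eigenvector_def DB_mat_def)
  define x where "x k = (if 1 \<le> k \<and> k \<le> n then v $ (k - 1) else 0)" for k
  have x: "x 0 = 0" "x (Suc n) = 0"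
    by (auto simp: x_def)
  have vec_x: "vec n (\<lambda>i. x (Suc i)) = v"
    using v(1) by (auto simp: x_def)
  obtain j where "j < n" "v $ j \<noteq> 0"
    using v(1,2) by (metis carrier_vecD eq_vecI index_zero_vec)
  then have "Suc j \<le> Suc n" "x (Suc j) \<noteq> 0"
    by (auto simp: x_def)
  moreover have "is_solution n t r w q lam x"
    using is_solution_iff_eigen_equation[where n = n and w = w, OF step w x] v(3) vec_x by metis
  ultimately show "is_eigenvalue n t r w q lam"
    unfolding is_eigenvalue_def by blast
qed

section \<open>The pencil determinant\<close>

lemma det_scale_rows:
  fixes A :: "'a :: comm_ring_1 mat"
  assumes A: "A \<in> carrier_mat n n"
  shows "det (mat n n (\<lambda>(i, j). c i * A $$ (i, j))) = (\<Prod>i<n. c i) * det A"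
proof -
  have "det (mat n n (\<lambda>(i, j). c i * A $$ (i, j)))
      = (\<Sum>p | p permutes {0..<n}. signof p * (\<Prod>i = 0..<n. c i * A $$ (i, p i)))"
    by (subst det_def'[of _ n]) (auto intro!: sum.cong prod.cong simp: permutes_in_image)
  also have "\<dots> = (\<Prod>i<n. c i) * det A"
    by (simp add: det_def'[OF A] prod.distrib sum_distrib_left lessThan_atLeast0 mult_ac)
  finally show ?thesis .
qed

text \<open>\<open>B - lam D = - D (lam - D\<inverse> B)\<close>, and \<open>D\<close> is diagonal.\<close>

lemma pencil_poly_eq_char_poly:
  assumes step: "\<And>k. k \<le> n \<Longrightarrow> step t k \<noteq> 0" and w: "\<And>k. k < n \<Longrightarrow> w k \<noteq> 0"
  shows "pencil_poly n t r w q
       = smult (\<Prod>i<n. - of_real (step t i * w i)) (char_poly (DB_mat n t r w q))"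
proof -
  let ?d = "\<lambda>i. - of_real (step t i * w i) :: complex"
  let ?M = "char_poly_matrix (DB_mat n t r w q)"
  have "map_mat (\<lambda>b. [:of_real b:]) (B_mat n t r q) - [:0, 1:] \<cdot>\<^sub>m map_mat (\<lambda>d. [:of_real d:]) (D_mat n t w)
      = mat n n (\<lambda>(i, j). [:?d i:] * ?M $$ (i, j))"
    using step w
    by (intro eq_matI) (auto simp: char_poly_matrix_def DB_mat_def B_mat_def D_mat_def)
  then have "pencil_poly n t r w q = (\<Prod>i<n. [:?d i:]) * det ?M"
    unfolding pencil_poly_def using DB_mat_carrier by (simp only: det_scale_rows char_poly_matrix_closed)
  also have "(\<Prod>i<n. [:?d i:]) = [:\<Prod>i<n. ?d i:]"
    by (induction n) (simp_all add: mult_ac)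
  finally show ?thesis by (simp add: char_poly_def)
qed

lemma sum_order_roots_eq_degree:
  fixes p :: "complex poly"
  assumes "p \<noteq> 0"
  shows "(\<Sum>z | poly p z = 0. order z p) = degree p"
  using assms size_proots_complex[of p] by (simp add: size_multiset_overloaded_eq)

theorem theorem1p2:
  fixes n :: nat and t r w q :: "nat \<Rightarrow> real"
  assumes "n \<ge> 1"
    and "\<And>k. k \<le> n \<Longrightarrow> t k < t (Suc k)"
    and "\<And>k. k \<le> n \<Longrightarrow> r k \<noteq> 0"
    and "\<And>k. k < n \<Longrightarrow> w k > 0"
  shows "(\<forall>lam. is_eigenvalue n t r w q lam \<longrightarrow> lam \<in> \<real>) \<and>
         pencil_poly n t r w q \<noteq> 0 \<and>
         finite {lam. is_eigenvalue n t r w q lam} \<and>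
         (\<Sum>lam | is_eigenvalue n t r w q lam. eig_multiplicity n t r w q lam) = n"
proof -
  have step: "step t k > 0" if "k \<le> n" for k
    using assms(2)[OF that] by (simp add: step_def)
  have step_nz: "\<And>k. k \<le> n \<Longrightarrow> step t k \<noteq> 0" and w_nz: "\<And>k. k < n \<Longrightarrow> w k \<noteq> 0"
    using step assms(4) by (metis less_irrefl)+
  let ?p = "pencil_poly n t r w q" and ?A = "DB_mat n t r w q"
  let ?c = "\<Prod>i<n. - of_real (step t i * w i) :: complex"
  have c: "?c \<noteq> 0"
    using step_nz w_nz by simp
  have p: "?p = smult ?c (char_poly ?A)"
    using step_nz w_nz by (rule pencil_poly_eq_char_poly)
  have "degree (char_poly ?A) = n" "monic (char_poly ?A)"
    using degree_monic_char_poly[OF DB_mat_carrier] by auto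
  then have deg: "degree ?p = n" and nz: "?p \<noteq> 0"
    using c unfolding p by auto
  have ev: "is_eigenvalue n t r w q lam \<longleftrightarrow> poly ?p lam = 0" for lam
    using is_eigenvalue_iff_eigenvalue[where n = n and w = w, OF step_nz w_nz] eigenvalue_root_char_poly[OF DB_mat_carrier] c
    by (simp add: p)
  have "\<forall>lam. is_eigenvalue n t r w q lam \<longrightarrow> lam \<in> \<real>"
    using eigenvalue_real[where n = n and w = w, OF step assms(4)] by blast
  then show ?thesis
    using nz poly_roots_finite[OF nz] sum_order_roots_eq_degree[OF nz] deg
    by (simp add: ev eig_multiplicity_def)
qed

end
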